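(* Consider the two-dimensional multi-dimensional relaxation scheme (R) for the rescaled Euler equations described in the context. It is low Mach number compliant in the following sense. Let all discrete quantities be formal power series in $\epsilon$. Any data with $$p^{(0)}=\mathrm{const},\qquad p^{(1)}=\mathrm{const},$$ and (discrete counterpart to $\mathrm{div}\,\mathbf v^{(0)}=0$) $$\mathscr D^{(0)}_{i+\frac12,j+\frac12} = \frac{\{ [u^{(0)}]_{i+\frac12} \}_{j+\frac12} }{2 \Delta x} + \frac{[ \{v^{(0)} \}_{i+\frac12} ]_{j+\frac12} }{2 \Delta y} = 0 \qquad \forall i,j$$ are solutions of the discrete limit equations of the scheme as $\epsilon\to0$.
   Context: Rescaled Euler equations: $\partial_t\rho+\nabla\cdot(\rho\mathbf v)=0$, $\partial_t(\rho\mathbf v)+\nabla\cdot(\rho\mathbf v\otimes\mathbf v+p/\epsilon^2\,\mathrm{Id})=0$, $\partial_t e+\nabla\cdot(\mathbf v(e+p))=0$, $e=\frac{p}{\gamma-1}+\frac12\epsilon^2\rho|\mathbf v|^2$, $\gamma>1$, $\mathbf v=(u,v)$, $\epsilon>0$ controlling the Mach number. Cells $(i,j)\in\mathbb Z^2$ of a Cartesian grid with spacings $\Delta x,\Delta y>0$, time step $\Delta t>0$. Cell quantities: $q=(\rho,\rho u,\rho v,e)$, with corresponding $u,v,p$. Notation for a grid function $q$ (in one index): $[q]_{i+\frac12}:=q_{i+1}-q_i$, $\{q\}_{i+\frac12}:=q_{i+1}+q_i$, $[q]_{i\pm1}:=q_{i+1}-q_{i-1}$, $\{\{q\}\}_{i\pm\frac12}:=q_{i+1}+2q_i+q_{i-1}$.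 In two dimensions the operators are composed, those with index $i$ acting in the first index, those with index $j$ in the second; e.g. $\{[q]_{i+\frac12}\}_{j+\frac12}=q_{i+1,j+1}-q_{i,j+1}+q_{i+1,j}-q_{ij}$. Scheme (R). It is the finite volume scheme $q^{n+1}_{ij}=q^n_{ij}-\frac{\Delta t}{\Delta x}(f_{i+\frac12,j}-f_{i-\frac12,j})-\frac{\Delta t}{\Delta y}(g_{i,j+\frac12}-g_{i,j-\frac12})$ with the following fluxes, all evaluated at time level $n$. Let $a>0$ be the relaxation parameter (it may depend on the edge). At the edge $(i+\frac12,j)$ set $$p^*_{i+\frac12,j} = \frac{ \{\{ \{ p \}_{i+\frac12} \}\}_{j\pm\frac12}}{8} - \frac{a \epsilon}{2} \left( \frac{ \{\{ [u]_{i+\frac12} \}\}_{j\pm\frac12} }{4} + \frac{\Delta x}{\Delta y} \frac{[\{ v\}_{i+\frac12}]_{j\pm1}}{4} \right ),$$ $$u^*_{i+\frac12,j} = \frac{\{\{ \{ u \}_{i+\frac12}\}\}_{j\pm\frac12}}{8} - \frac{1}{2a \epsilon} \frac{\{\{ [p]_{i+\frac12} \}\}_{j\pm\frac12}}{4},$$ $$\rho^*_{i+\frac12,j,\mathrm L} = \frac{\rho_{ij}}{1 + \frac{\rho_{ij} \epsilon}{2a} \left( \frac{\{\{[u]_{i+\frac12}\}\}_{j\pm\frac12}}{4} + \frac{\Delta x}{\Delta y} \frac{[\{ v\}_{i+\frac12}]_{j\pm1}}{4} \right ) - \frac{\rho_{ij}}{ 2 a^2 } \frac{\{\{ [p]_{i+\frac12}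 \}\}_{j\pm\frac12}}{4}},$$ $$\rho^*_{i+\frac12,j,\mathrm R} = \frac{\rho_{i+1,j}}{1 + \frac{\rho_{i+1,j} \epsilon}{2a} \left( \frac{\{\{[u]_{i+\frac12}\}\}_{j\pm\frac12}}{4} + \frac{\Delta x}{\Delta y} \frac{[\{ v\}_{i+\frac12}]_{j\pm1}}{4} \right ) + \frac{\rho_{i+1,j}}{ 2 a^2 } \frac{\{\{ [p]_{i+\frac12} \}\}_{j\pm\frac12}}{4}},$$ $$\frac{e^*_{i+\frac12,j,\mathrm L}}{\rho^*_{i+\frac12,j,\mathrm L}}=\frac{e_{ij}}{\rho_{ij}}+\epsilon\frac{p_{ij}u_{ij}-p^*_{i+\frac12,j}u^*_{i+\frac12,j}}{a},\qquad \frac{e^*_{i+\frac12,j,\mathrm R}}{\rho^*_{i+\frac12,j,\mathrm R}}=\frac{e_{i+1,j}}{\rho_{i+1,j}}+\epsilon\frac{p^*_{i+\frac12,j}u^*_{i+\frac12,j}-p_{i+1,j}u_{i+1,j}}{a},$$ $v^*_{i+\frac12,j,\mathrm L}=v_{ij}$, $v^*_{i+\frac12,j,\mathrm R}=v_{i+1,j}$. The $x$-flux is the flux associated with the intermediate state of the approximate Riemann solver at $x/t=0$, i.e. (omitting the index $i+\frac12,j$) $$f=\left(u^*\rho^*_S,\ (u^* )^2\rho^*_S+\frac{p^*}{\epsilon^2},\ u^*v^*_S\rho^*_S,\ u^*e^*_S+u^*p^*\right),$$ with $S=\mathrm L$ if $u^*>0$ and $S=\mathrm R$ otherwise. The $y$-flux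 $g_{i,j+\frac12}$ is defined analogously by exchanging the roles of $x$ and $y$, $i$ and $j$, $u$ and $v$; in particular $$p^*_{i,j+\frac12} = \frac{\{ \{\{p \}\}_{i\pm\frac12}\}_{j+\frac12} }{8} - \frac{a\epsilon}{2} \left( \frac{\Delta y}{\Delta x} \frac{\{[u]_{i\pm1} \}_{j+\frac12}}{4} + \frac{[ \{\{v\}\}_{i\pm\frac12}]_{j+\frac12} }{4}\right ),\quad v^*_{i,j+\frac12} = \frac{ \{ \{\{ v \}\}_{i\pm\frac12}\}_{j+\frac12} }{8} - \frac1{2a\epsilon} \frac{ [ \{\{ p \}\}_{i\pm\frac12}]_{j+\frac12}}{4}.$$ Formal asymptotics: every cell quantity and $a$ is expanded as a formal power series $q_{ij}=q_{ij}^{(0)}+\epsilon q_{ij}^{(1)}+\epsilon^2q_{ij}^{(2)}+\dots$ (with $\rho^{(0)},a^{(0)}>0$; $\Delta t,\Delta x,\Delta y$ held fixed), is inserted into the scheme, and coefficients of equal powers of $\epsilon$ are collected; $X^{(k)}$ denotes the coefficient of $\epsilon^k$ of $X$. (In the selection of $S$, the sign of a formal series is that of its lowest-order nonvanishing coefficient.) "const" means independent of the cell $(i,j)$ and of time. The discrete limit equations are: the equations at orders $\epsilon^{-2}$ and $\epsilon^{-1}$ in the update equations for both momentum components (i.e. the vanishing of the coefficients of $\epsilon^{-2}$ and $\epsilon^{-1}$ in the total flux differences, there being no time-difference contribution at these orders), and the order $\epsilon^0$ equation of the energy update with $e^{(0)}$ constant in time (i.e. the vanishing of the order $\epsilon^0$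 coefficient of the total flux difference for $e$). *)

theory Defs
  imports "HOL-Computational_Algebra.Formal_Laurent_Series"
begin

type_synonym 'a grid = "int \<Rightarrow> int \<Rightarrow> 'a"


section \<open>Difference and summation operators\<close>

text \<open>
  For a grid function in one index, a value belonging to the edge \<open>i + 1/2\<close> is stored at \<open>i\<close>.
  \<open>ejump\<close>, \<open>esum\<close>, \<open>cjump\<close>, \<open>csum\<close> are, in this order, the brackets
  $[q]_{i+1/2}$, $\{q\}_{i+1/2}$, $[q]_{i\pm 1}$ and $\{\{q\}\}_{i\pm 1/2}$.
\<close>

definition ejump :: "(int \<Rightarrow> 'a::comm_ring_1) \<Rightarrow> int \<Rightarrow> 'a" where
  "ejump q i = q (i + 1) - q i"

definition esum :: "(int \<Rightarrow> 'a::comm_ring_1) \<Rightarrow> int \<Rightarrow> 'a" where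
  "esum q i = q (i + 1) + q i"

definition cjump :: "(int \<Rightarrow> 'a::comm_ring_1) \<Rightarrow> int \<Rightarrow> 'a" where
  "cjump q i = q (i + 1) - q (i - 1)"

definition csum :: "(int \<Rightarrow> 'a::comm_ring_1) \<Rightarrow> int \<Rightarrow> 'a" where
  "csum q i = q (i + 1) + 2 * q i + q (i - 1)"

text \<open>Action of such an operator in the first, respectively the second, index.\<close>

definition inI :: "((int \<Rightarrow> 'a) \<Rightarrow> int \<Rightarrow> 'a) \<Rightarrow> 'a grid \<Rightarrow> 'a grid" where
  "inI F q i j = F (\<lambda>k. q k j) i"

definition inJ :: "((int \<Rightarrow> 'a) \<Rightarrow> int \<Rightarrow> 'a) \<Rightarrow> 'a grid \<Rightarrow> 'a grid" where
  "inJ F q i j = F (\<lambda>k. q i k) j"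

definition discrete_div :: "real \<Rightarrow> real \<Rightarrow> real grid \<Rightarrow> real grid \<Rightarrow> real grid" where
  "discrete_div \<Delta>x \<Delta>y u v i j =
     inJ esum (inI ejump u) i j / (2 * \<Delta>x) + inJ ejump (inI esum v) i j / (2 * \<Delta>y)"


section \<open>The scheme, over formal series in the Mach number parameter\<close>

text \<open>
  The quantities occurring in the scheme are formal Laurent series over the reals, whose
  variable is the parameter \<open>\<epsilon>\<close>. (The scheme contains negative powers of \<open>\<epsilon>\<close>, so power
  series do not suffice for the fluxes, although the data are power series.)
\<close>

abbreviation eps :: "real fls" where
  "eps \<equiv> fls_X"

text \<open>The sign of a formal series is that of its lowest-order nonvanishing coefficient.\<close>

definition fls_pos :: "real fls \<Rightarrow> bool" where
  "fls_pos x \<longleftrightarrow> x \<noteq> 0 \<and> fls_nth x (fls_subdegree x) > 0"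

text \<open>The primitive variables at one time level.\<close>

record state =
  dens :: "real fls grid"
  velx :: "real fls grid"
  vely :: "real fls grid"
  pres :: "real fls grid"

definition ener :: "real \<Rightarrow> state \<Rightarrow> real fls grid" where
  "ener \<gamma> q i j = pres q i j / fls_const (\<gamma> - 1)
     + eps\<^sup>2 * dens q i j * ((velx q i j)\<^sup>2 + (vely q i j)\<^sup>2) / 2"

text \<open>Components of the vector of conserved quantities and of the corresponding fluxes.\<close>

record comps =
  cmass :: "real fls"
  cmomx :: "real fls"
  cmomy :: "real fls"
  cener :: "real fls"

definition conserved :: "real \<Rightarrow> state \<Rightarrow> int \<Rightarrow> int \<Rightarrow> comps" where
  "conserved \<gamma> q i j =
     \<lparr>cmass = dens q i j, cmomx = dens q i j * velx q i j, cmomy = dens q i j * vely q i j,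
      cener = ener \<gamma> q i j\<rparr>"

text \<open>
  Quantities at the edge \<open>(i + 1/2, j)\<close>. The relaxation parameter on that edge is \<open>a i j\<close>.
  \<open>edge_div\<close> is the bracket
  $\{\{[u]_{i+1/2}\}\}_{j\pm 1/2}/4 + (\Delta x/\Delta y)\,[\{v\}_{i+1/2}]_{j\pm 1}/4$.
\<close>

definition edge_div :: "real \<Rightarrow> real \<Rightarrow> state \<Rightarrow> real fls grid" where
  "edge_div \<Delta>x \<Delta>y q i j =
     inJ csum (inI ejump (velx q)) i j / 4
     + fls_const (\<Delta>x / \<Delta>y) * (inJ cjump (inI esum (vely q)) i j / 4)"

definition p_star :: "real \<Rightarrow> real \<Rightarrow> real fls grid \<Rightarrow> state \<Rightarrow> real fls grid" where
  "p_star \<Delta>x \<Delta>y a q i j =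
     inJ csum (inI esum (pres q)) i j / 8 - a i j * eps / 2 * edge_div \<Delta>x \<Delta>y q i j"

definition u_star :: "real fls grid \<Rightarrow> state \<Rightarrow> real fls grid" where
  "u_star a q i j =
     inJ csum (inI esum (velx q)) i j / 8
     - 1 / (2 * a i j * eps) * (inJ csum (inI ejump (pres q)) i j / 4)"

definition rho_star_L :: "real \<Rightarrow> real \<Rightarrow> real fls grid \<Rightarrow> state \<Rightarrow> real fls grid" where
  "rho_star_L \<Delta>x \<Delta>y a q i j =
     dens q i j /
       (1 + dens q i j * eps / (2 * a i j) * edge_div \<Delta>x \<Delta>y q i j
          - dens q i j / (2 * (a i j)\<^sup>2) * (inJ csum (inI ejump (pres q)) i j / 4))"

definition rho_star_R :: "real \<Rightarrow> real \<Rightarrow> real fls grid \<Rightarrow> state \<Rightarrow> real fls grid" where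
  "rho_star_R \<Delta>x \<Delta>y a q i j =
     dens q (i + 1) j /
       (1 + dens q (i + 1) j * eps / (2 * a i j) * edge_div \<Delta>x \<Delta>y q i j
          + dens q (i + 1) j / (2 * (a i j)\<^sup>2) * (inJ csum (inI ejump (pres q)) i j / 4))"

definition e_star_L :: "real \<Rightarrow> real \<Rightarrow> real \<Rightarrow> real fls grid \<Rightarrow> state \<Rightarrow> real fls grid" where
  "e_star_L \<gamma> \<Delta>x \<Delta>y a q i j =
     rho_star_L \<Delta>x \<Delta>y a q i j *
       (ener \<gamma> q i j / dens q i j
        + eps * ((pres q i j * velx q i j - p_star \<Delta>x \<Delta>y a q i j * u_star a q i j) / a i j))"

definition e_star_R :: "real \<Rightarrow> real \<Rightarrow> real \<Rightarrow> real fls grid \<Rightarrow> state \<Rightarrow> real fls grid" where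
  "e_star_R \<gamma> \<Delta>x \<Delta>y a q i j =
     rho_star_R \<Delta>x \<Delta>y a q i j *
       (ener \<gamma> q (i + 1) j / dens q (i + 1) j
        + eps * ((p_star \<Delta>x \<Delta>y a q i j * u_star a q i j
                  - pres q (i + 1) j * velx q (i + 1) j) / a i j))"

definition flux_x ::
  "real \<Rightarrow> real \<Rightarrow> real \<Rightarrow> real fls grid \<Rightarrow> state \<Rightarrow> int \<Rightarrow> int \<Rightarrow> comps" where
  "flux_x \<gamma> \<Delta>x \<Delta>y a q i j =
     (let us = u_star a q i j;
          ps = p_star \<Delta>x \<Delta>y a q i j;
          left = fls_pos us;
          \<rho>s = (if left then rho_star_L \<Delta>x \<Delta>y a q i j else rho_star_R \<Delta>x \<Delta>y a q i j);
          vs = (if left then vely q i j else vely q (i + 1) j);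
          es = (if left then e_star_L \<gamma> \<Delta>x \<Delta>y a q i j else e_star_R \<gamma> \<Delta>x \<Delta>y a q i j)
      in \<lparr>cmass = us * \<rho>s, cmomx = us\<^sup>2 * \<rho>s + ps / eps\<^sup>2, cmomy = us * vs * \<rho>s,
          cener = us * es + us * ps\<rparr>)"

text \<open>
  The flux across the edge \<open>(i, j + 1/2)\<close>, whose relaxation parameter is \<open>b i j\<close>, is obtained
  by exchanging the roles of the two coordinates. The lemmas below spell out the resulting
  intermediate pressure and normal velocity.
\<close>

definition transp :: "'a grid \<Rightarrow> 'a grid" where
  "transp q i j = q j i"

definition transp_state :: "state \<Rightarrow> state" where
  "transp_state q =
     \<lparr>dens = transp (dens q), velx = transp (vely q), vely = transp (velx q),
      pres = transp (pres q)\<rparr>"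

definition flux_y ::
  "real \<Rightarrow> real \<Rightarrow> real \<Rightarrow> real fls grid \<Rightarrow> state \<Rightarrow> int \<Rightarrow> int \<Rightarrow> comps" where
  "flux_y \<gamma> \<Delta>x \<Delta>y b q i j =
     (let f = flux_x \<gamma> \<Delta>y \<Delta>x (transp b) (transp_state q) j i
      in \<lparr>cmass = cmass f, cmomx = cmomy f, cmomy = cmomx f, cener = cener f\<rparr>)"

lemma p_star_y:
  "p_star \<Delta>y \<Delta>x (transp b) (transp_state q) j i =
     inJ esum (inI csum (pres q)) i j / 8
     - b i j * eps / 2 *
       (fls_const (\<Delta>y / \<Delta>x) * (inJ esum (inI cjump (velx q)) i j / 4)
        + inJ ejump (inI csum (vely q)) i j / 4)"
  by (simp add: p_star_def edge_div_def transp_state_def transp_def inI_def inJ_def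
      esum_def ejump_def csum_def cjump_def algebra_simps)

lemma v_star_y:
  "u_star (transp b) (transp_state q) j i =
     inJ esum (inI csum (vely q)) i j / 8
     - 1 / (2 * b i j * eps) * (inJ ejump (inI csum (pres q)) i j / 4)"
  by (simp add: u_star_def transp_state_def transp_def inI_def inJ_def
      esum_def ejump_def csum_def algebra_simps)

text \<open>
  \<open>sel\<close> selects one of the four conserved quantities; \<open>update_defect\<close> vanishes iff that
  component of the update from \<open>q\<close> to \<open>q'\<close> holds in the cell \<open>(i, j)\<close>.
\<close>

definition flux_difference ::
  "real \<Rightarrow> real \<Rightarrow> real \<Rightarrow> real \<Rightarrow> real fls grid \<Rightarrow> real fls grid \<Rightarrow> (comps \<Rightarrow> real fls)
   \<Rightarrow> state \<Rightarrow> real fls grid" where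
  "flux_difference \<gamma> \<Delta>t \<Delta>x \<Delta>y a b sel q i j =
     fls_const (\<Delta>t / \<Delta>x) *
       (sel (flux_x \<gamma> \<Delta>x \<Delta>y a q i j) - sel (flux_x \<gamma> \<Delta>x \<Delta>y a q (i - 1) j))
     + fls_const (\<Delta>t / \<Delta>y) *
       (sel (flux_y \<gamma> \<Delta>x \<Delta>y b q i j) - sel (flux_y \<gamma> \<Delta>x \<Delta>y b q i (j - 1)))"

definition update_defect ::
  "real \<Rightarrow> real \<Rightarrow> real \<Rightarrow> real \<Rightarrow> real fls grid \<Rightarrow> real fls grid \<Rightarrow> (comps \<Rightarrow> real fls)
   \<Rightarrow> state \<Rightarrow> state \<Rightarrow> real fls grid" where
  "update_defect \<gamma> \<Delta>t \<Delta>x \<Delta>y a b sel q q' i j =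
     sel (conserved \<gamma> q' i j) - sel (conserved \<gamma> q i j)
     + flux_difference \<gamma> \<Delta>t \<Delta>x \<Delta>y a b sel q i j"


section \<open>The discrete limit equations\<close>

text \<open>The data are power series in \<open>\<epsilon>\<close>; the first argument is the time level.\<close>

type_synonym data = "nat \<Rightarrow> real fps grid"

definition series_grid :: "data \<Rightarrow> nat \<Rightarrow> real fls grid" where
  "series_grid q n i j = fps_to_fls (q n i j)"

definition state_of :: "data \<Rightarrow> data \<Rightarrow> data \<Rightarrow> data \<Rightarrow> nat \<Rightarrow> state" where
  "state_of \<rho> u v p n =
     \<lparr>dens = series_grid \<rho> n, velx = series_grid u n, vely = series_grid v n,
      pres = series_grid p n\<rparr>"

text \<open>
  At the orders \<open>-2\<close> and \<open>-1\<close> the time differences of the momenta do not contribute, and at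
  order \<open>0\<close> the time difference of the energy drops out because \<open>e\<close> is constant in
  time at that order. Thus all these equations say that a coefficient of a total flux difference
  vanishes, see \<open>discrete_limit_equations_iff\<close> below.
\<close>

definition discrete_limit_equations ::
  "real \<Rightarrow> real \<Rightarrow> real \<Rightarrow> real \<Rightarrow> data \<Rightarrow> data \<Rightarrow> data \<Rightarrow> data \<Rightarrow> data \<Rightarrow> data \<Rightarrow> bool" where
  "discrete_limit_equations \<gamma> \<Delta>t \<Delta>x \<Delta>y a b \<rho> u v p \<longleftrightarrow>
     (let Q = state_of \<rho> u v p;
          defect = (\<lambda>sel n. update_defect \<gamma> \<Delta>t \<Delta>x \<Delta>y (series_grid a n) (series_grid b n)
                               sel (Q n) (Q (Suc n)))
      in \<forall>n i j.
           fls_nth (defect cmomx n i j) (-2) = 0 \<and>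
           fls_nth (defect cmomx n i j) (-1) = 0 \<and>
           fls_nth (defect cmomy n i j) (-2) = 0 \<and>
           fls_nth (defect cmomy n i j) (-1) = 0 \<and>
           fls_nth (ener \<gamma> (Q (Suc n)) i j) 0 = fls_nth (ener \<gamma> (Q n) i j) 0 \<and>
           fls_nth (defect cener n i j) 0 = 0)"

lemma discrete_limit_equations_iff:
  "discrete_limit_equations \<gamma> \<Delta>t \<Delta>x \<Delta>y a b \<rho> u v p \<longleftrightarrow>
     (let Q = state_of \<rho> u v p;
          flux = (\<lambda>sel n. flux_difference \<gamma> \<Delta>t \<Delta>x \<Delta>y (series_grid a n) (series_grid b n)
                             sel (Q n))
      in \<forall>n i j.
           fls_nth (flux cmomx n i j) (-2) = 0 \<and>
           fls_nth (flux cmomx n i j) (-1) = 0 \<and>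
           fls_nth (flux cmomy n i j) (-2) = 0 \<and>
           fls_nth (flux cmomy n i j) (-1) = 0 \<and>
           fls_nth (ener \<gamma> (Q (Suc n)) i j) 0 = fls_nth (ener \<gamma> (Q n) i j) 0 \<and>
           fls_nth (flux cener n i j) 0 = 0)"
proof -
  have momentum: "fls_nth (fps_to_fls f * fps_to_fls g) k = 0"
    if "k < 0" for f g :: "real fps" and k
    using that by (simp flip: fls_times_fps_to_fls)
  show ?thesis
    by (simp add: discrete_limit_equations_def Let_def update_defect_def conserved_def
        state_of_def series_grid_def momentum cong: conj_cong)
qed

end

theory Submission
  imports Defs
begin

text \<open>
  Write $p = p^{(0)} + \epsilon p^{(1)} + \epsilon^2 \pi$. As $p^{(0)}$ and $p^{(1)}$ are constant,
  every pressure jump is $O(\epsilon^2)$, which compensates the negative power of $\epsilon$ in $u^*$.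
  The velocity bracket at an edge is, up to a factor, the sum of the discrete divergences at the two
  ends of the edge, hence $O(\epsilon)$, so that $p^* = p^{(0)} + \epsilon p^{(1)} + O(\epsilon^2)$.
  The singular part of $p^*/\epsilon^2$ therefore does not depend on the edge and cancels in the
  momentum updates. To leading order the energy $e^*$ is $p^{(0)}/(\gamma - 1)$ on either side of
  the edge, so the energy flux is a constant multiple of the averaged normal velocity, and its
  difference over a cell is proportional to the sum of the discrete divergences at the four corners.
\<close>

section \<open>Laurent series without a singular part\<close>

text \<open>Absence of negative powers and the value at order 0 are recorded together, so that both
  pass through sums, products and quotients by one set of introduction rules.\<close>

definition starts_with :: "real fls \<Rightarrow> real \<Rightarrow> bool" where
  "starts_with x c \<longleftrightarrow> (\<exists>f. x = fps_to_fls f \<and> fps_nth f 0 = c)"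

lemma starts_with_fps_to_fls: "starts_with (fps_to_fls f) (fps_nth f 0)"
  by (auto simp: starts_with_def)

lemma starts_with_nth_0: "starts_with x c \<Longrightarrow> fls_nth x 0 = c"
  by (auto simp: starts_with_def)

lemma starts_with_nth_neg: "starts_with x c \<Longrightarrow> k < 0 \<Longrightarrow> fls_nth x k = 0"
  by (auto simp: starts_with_def)

lemma starts_with_const: "starts_with (fls_const c) c"
  unfolding starts_with_def by (intro exI[of _ "fps_const c"]) simp

lemma starts_with_numeral: "starts_with (numeral k) (numeral k)"
  unfolding starts_with_def
  by (intro exI[of _ "numeral k"]) (simp add: numeral_fps_const)

lemma starts_with_1: "starts_with 1 1"
  unfolding starts_with_def by (intro exI[of _ 1]) simp

lemma starts_with_eps: "starts_with eps 0"
  unfolding starts_with_def by (intro exI[of _ fps_X]) simp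

lemma starts_with_add:
  "starts_with x c \<Longrightarrow> starts_with y d \<Longrightarrow> starts_with (x + y) (c + d)"
  unfolding starts_with_def by (metis fps_add_nth fps_to_fls_plus)

lemma starts_with_diff:
  "starts_with x c \<Longrightarrow> starts_with y d \<Longrightarrow> starts_with (x - y) (c - d)"
  unfolding starts_with_def by (metis fps_sub_nth fps_to_fls_minus)

lemma starts_with_mult:
  "starts_with x c \<Longrightarrow> starts_with y d \<Longrightarrow> starts_with (x * y) (c * d)"
  unfolding starts_with_def by (metis fps_mult_nth_0 fls_times_fps_to_fls)

lemma starts_with_power:
  "starts_with x c \<Longrightarrow> starts_with (x ^ n) (c ^ n)"
  by (induction n) (auto intro: starts_with_1 starts_with_mult)

text \<open>A power series with nonzero constant coefficient is a unit among power series;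
  uniqueness of inverses identifies its inverse there with the one in the field of Laurent
  series.\<close>

lemma starts_with_inverse:
  assumes "starts_with x c" "c \<noteq> 0"
  shows "starts_with (inverse x) (inverse c)"
proof -
  obtain f where f: "x = fps_to_fls f" "fps_nth f 0 = c"
    using assms(1) by (auto simp: starts_with_def)
  have "f * inverse f = 1"
    using f(2) assms(2) by (intro inverse_mult_eq_1') auto
  then have "x * fps_to_fls (inverse f) = 1"
    by (simp add: f(1) flip: fls_times_fps_to_fls)
  then have "inverse x = fps_to_fls (inverse f)"
    by (rule inverse_unique)
  then show ?thesis
    using f(2) by (auto simp: starts_with_def)
qed

lemma starts_with_divide:
  "starts_with x c \<Longrightarrow> starts_with y d \<Longrightarrow> d \<noteq> 0 \<Longrightarrow> starts_with (x / y) (c / d)"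
  by (simp add: divide_inverse starts_with_mult starts_with_inverse)

lemmas starts_with_intros =
  starts_with_const starts_with_numeral starts_with_1 starts_with_eps starts_with_add
  starts_with_diff starts_with_mult starts_with_power starts_with_divide

lemma starts_with_0_imp_eps_mult:
  assumes "starts_with x 0"
  obtains y c where "x = eps * y" "starts_with y c"
proof -
  obtain f where f: "x = fps_to_fls f" "fps_nth f 0 = 0"
    using assms by (auto simp: starts_with_def)
  have "f = fps_X * fps_shift 1 f"
    using f(2) by (auto simp: fps_eq_iff)
  then have "fps_to_fls f = fps_to_fls (fps_X * fps_shift 1 f)"
    by (rule arg_cong)
  then have "x = eps * fps_to_fls (fps_shift 1 f)"
    by (simp add: f(1) fls_times_fps_to_fls)
  then show ?thesis
    using that starts_with_fps_to_fls by blast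
qed

text \<open>
  \<open>p0\<close>, \<open>p1\<close> are $p^{(0)}$, $p^{(1)}$, whereas \<open>\<rho>0\<close>, \<open>u0\<close>, \<open>v0\<close>, \<open>a0\<close>, \<open>\<pi>0\<close> are the grids of
  order-0 coefficients. The locale also covers the $y$-flux, see \<open>low_mach_state_transp\<close>.
\<close>

locale low_mach_state =
  fixes q :: state and a :: "real fls grid" and \<Delta>x \<Delta>y p0 p1 :: real
    and \<rho>0 u0 v0 a0 \<pi>0 :: "real grid" and \<pi> :: "real fls grid"
  assumes spacing: "\<Delta>x > 0" "\<Delta>y > 0"
    and dens: "starts_with (dens q i j) (\<rho>0 i j)" and dens_pos: "\<rho>0 i j > 0"
    and velx: "starts_with (velx q i j) (u0 i j)"
    and vely: "starts_with (vely q i j) (v0 i j)"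
    and relax: "starts_with (a i j) (a0 i j)" and relax_pos: "a0 i j > 0"
    and pres: "pres q i j = fls_const p0 + eps * fls_const p1 + eps\<^sup>2 * \<pi> i j"
    and pert: "starts_with (\<pi> i j) (\<pi>0 i j)"
    and div_free: "discrete_div \<Delta>x \<Delta>y u0 v0 i j = 0"
begin

section \<open>Leading orders of the intermediate states and of the fluxes\<close>

lemma starts_with_edge_operators:
  assumes "\<And>i j. starts_with (w i j) (w0 i j)"
  shows "starts_with (inJ csum (inI esum w) i j) (inJ csum (inI esum w0) i j)"
    and "starts_with (inJ csum (inI ejump w) i j) (inJ csum (inI ejump w0) i j)"
    and "starts_with (inJ cjump (inI esum w) i j) (inJ cjump (inI esum w0) i j)"
  unfolding inI_def inJ_def csum_def cjump_def esum_def ejump_def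
  by (intro starts_with_intros assms)+

lemma edge_div_starts_with: "starts_with (edge_div \<Delta>x \<Delta>y q i j) 0"
proof -
  \<comment> \<open>In the second index, \<open>csum\<close> is the sum of two neighbouring
    \<open>esum\<close>, and \<open>cjump\<close> the sum of two neighbouring \<open>ejump\<close>.
    This splits the bracket into its contributions at the corners (i+1/2, j+1/2) and (i+1/2,
    j-1/2).\<close>
  have "inJ csum (inI ejump u0) i j / 4 + \<Delta>x / \<Delta>y * (inJ cjump (inI esum v0) i j / 4)
      = \<Delta>x / 2 * (discrete_div \<Delta>x \<Delta>y u0 v0 i j + discrete_div \<Delta>x \<Delta>y u0 v0 i (j - 1))"
    using spacing
    by (simp add: discrete_div_def inI_def inJ_def csum_def cjump_def esum_def ejump_def
        field_simps)
  also have "\<dots> = 0"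
    by (simp add: div_free)
  finally have eq: "inJ csum (inI ejump u0) i j / 4
      + \<Delta>x / \<Delta>y * (inJ cjump (inI esum v0) i j / 4) = 0" .
  have "starts_with (edge_div \<Delta>x \<Delta>y q i j)
    (inJ csum (inI ejump u0) i j / 4 + \<Delta>x / \<Delta>y * (inJ cjump (inI esum v0) i j / 4))"
    unfolding edge_div_def
    by (intro starts_with_intros starts_with_edge_operators velx vely) simp_all
  then show ?thesis
    by (simp only: eq)
qed

lemma csum_ejump_pres:
  "inJ csum (inI ejump (pres q)) i j = eps\<^sup>2 * inJ csum (inI ejump \<pi>) i j"
  by (simp add: inI_def inJ_def csum_def ejump_def pres algebra_simps)

text \<open>The weights of \<open>esum\<close> and \<open>csum\<close> add up to 2 and 4; the
  resulting 8 cancels the normalisation in \<open>p_star\<close>.\<close>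

lemma csum_esum_pres:
  "inJ csum (inI esum (pres q)) i j
     = 8 * (fls_const p0 + eps * fls_const p1) + eps\<^sup>2 * inJ csum (inI esum \<pi>) i j"
  by (simp add: inI_def inJ_def csum_def esum_def pres algebra_simps)

text \<open>The momentum flux divides \<open>p_star\<close> by eps^2, so the leading coefficient
  alone is not enough: two orders are made explicit and the remainder is kept free of negative
  powers.\<close>

lemma p_star_expansion:
  obtains r c where
    "p_star \<Delta>x \<Delta>y a q i j = fls_const p0 + eps * fls_const p1 + eps\<^sup>2 * r"
    "starts_with r c"
proof -
  \<comment> \<open>The bracket yields one factor \<open>eps\<close> and its prefactor in
    \<open>p_star\<close> another, so the divergence term goes into the remainder.\<close>
  obtain E c where E: "edge_div \<Delta>x \<Delta>y q i j = eps * E" "starts_with E c"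
    using edge_div_starts_with by (rule starts_with_0_imp_eps_mult)
  let ?r = "inJ csum (inI esum \<pi>) i j / 8 - a i j / 2 * E"
  have "p_star \<Delta>x \<Delta>y a q i j = fls_const p0 + eps * fls_const p1 + eps\<^sup>2 * ?r"
    unfolding p_star_def csum_esum_pres E(1)
    by (simp add: algebra_simps power2_eq_square add_divide_distrib)
  moreover have "starts_with ?r (inJ csum (inI esum \<pi>0) i j / 8 - a0 i j / 2 * c)"
    by (intro starts_with_intros starts_with_edge_operators pert relax E(2)) simp_all
  ultimately show ?thesis
    by (rule that)
qed

lemma p_star_starts_with: "starts_with (p_star \<Delta>x \<Delta>y a q i j) p0"
proof -
  obtain r c where r: "p_star \<Delta>x \<Delta>y a q i j = fls_const p0 + eps * fls_const p1 + eps\<^sup>2 * r"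
    "starts_with r c"
    by (rule p_star_expansion)
  \<comment> \<open>The zeros are the order-0 coefficients of \<open>eps\<close>. The value is given
    in the shape that the introduction rules produce and is simplified afterwards, here and
    below.\<close>
  have "starts_with (p_star \<Delta>x \<Delta>y a q i j) (p0 + 0 * p1 + 0\<^sup>2 * c)"
    unfolding r(1) by (intro starts_with_intros r(2))
  then show ?thesis
    by simp
qed

lemma u_star_starts_with: "starts_with (u_star a q i j) (inJ csum (inI esum u0) i j / 8)"
proof -
  have nz: "a0 i j \<noteq> 0"
    using relax_pos[of i j] by simp
  have "u_star a q i j = inJ csum (inI esum (velx q)) i j / 8
      - eps / (2 * a i j) * (inJ csum (inI ejump \<pi>) i j / 4)"
    unfolding u_star_def csum_ejump_pres by (simp add: power2_eq_square)
  moreover have "starts_with \<dots> (inJ csum (inI esum u0) i j / 8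
      - 0 / (2 * a0 i j) * (inJ csum (inI ejump \<pi>0) i j / 4))"
    by (intro starts_with_intros starts_with_edge_operators velx relax pert) (use nz in simp_all)
  ultimately show ?thesis
    by simp
qed

text \<open>Both corrections in each denominator carry a positive power of \<open>eps\<close>, so
  the denominators start with 1.\<close>

lemma rho_star_starts_with:
  shows "starts_with (rho_star_L \<Delta>x \<Delta>y a q i j) (\<rho>0 i j)"
    and "starts_with (rho_star_R \<Delta>x \<Delta>y a q i j) (\<rho>0 (i + 1) j)"
proof -
  have nz: "a0 i j \<noteq> 0"
    using relax_pos[of i j] by simp
  have "starts_with (rho_star_L \<Delta>x \<Delta>y a q i j)
      (\<rho>0 i j / (1 + \<rho>0 i j * 0 / (2 * a0 i j) * 0
        - \<rho>0 i j / (2 * (a0 i j)\<^sup>2) * (0\<^sup>2 * inJ csum (inI ejump \<pi>0) i j / 4)))"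
    unfolding rho_star_L_def csum_ejump_pres
    by (intro starts_with_intros starts_with_edge_operators edge_div_starts_with relax pert dens)
      (use nz in simp_all)
  then show "starts_with (rho_star_L \<Delta>x \<Delta>y a q i j) (\<rho>0 i j)"
    by simp
  have "starts_with (rho_star_R \<Delta>x \<Delta>y a q i j)
      (\<rho>0 (i + 1) j / (1 + \<rho>0 (i + 1) j * 0 / (2 * a0 i j) * 0
        + \<rho>0 (i + 1) j / (2 * (a0 i j)\<^sup>2) * (0\<^sup>2 * inJ csum (inI ejump \<pi>0) i j / 4)))"
    unfolding rho_star_R_def csum_ejump_pres
    by (intro starts_with_intros starts_with_edge_operators edge_div_starts_with relax pert dens)
      (use nz in simp_all)
  then show "starts_with (rho_star_R \<Delta>x \<Delta>y a q i j) (\<rho>0 (i + 1) j)"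
    by simp
qed

lemma pres_starts_with: "starts_with (pres q i j) p0"
proof -
  have "starts_with (pres q i j) (p0 + 0 * p1 + 0\<^sup>2 * \<pi>0 i j)"
    unfolding pres by (intro starts_with_intros pert)
  then show ?thesis
    by simp
qed

lemma ener_starts_with:
  assumes "\<gamma> \<noteq> 1"
  shows "starts_with (ener \<gamma> q i j) (p0 / (\<gamma> - 1))"
proof -
  have "starts_with (ener \<gamma> q i j)
      (p0 / (\<gamma> - 1) + 0\<^sup>2 * \<rho>0 i j * ((u0 i j)\<^sup>2 + (v0 i j)\<^sup>2) / 2)"
    unfolding ener_def
    by (intro starts_with_intros pres_starts_with dens velx vely) (use assms in simp_all)
  then show ?thesis
    by simp
qed

text \<open>The work term has a factor \<open>eps\<close>, and to leading order the density
  multiplied in cancels the density divided out.\<close>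

lemma e_star_starts_with:
  assumes "\<gamma> \<noteq> 1"
  shows "starts_with (e_star_L \<gamma> \<Delta>x \<Delta>y a q i j) (p0 / (\<gamma> - 1))"
    and "starts_with (e_star_R \<gamma> \<Delta>x \<Delta>y a q i j) (p0 / (\<gamma> - 1))"
proof -
  have nz: "a0 i j \<noteq> 0" "\<rho>0 i j \<noteq> 0" "\<rho>0 (i + 1) j \<noteq> 0"
    using relax_pos[of i j] dens_pos[of i j] dens_pos[of "i + 1" j] by simp_all
  let ?us = "inJ csum (inI esum u0) i j / 8"
  have "starts_with (e_star_L \<gamma> \<Delta>x \<Delta>y a q i j)
      (\<rho>0 i j * (p0 / (\<gamma> - 1) / \<rho>0 i j + 0 * ((p0 * u0 i j - p0 * ?us) / a0 i j)))"
    unfolding e_star_L_def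
    by (intro starts_with_intros rho_star_starts_with ener_starts_with pres_starts_with
        p_star_starts_with u_star_starts_with dens velx relax assms nz)
  then show "starts_with (e_star_L \<gamma> \<Delta>x \<Delta>y a q i j) (p0 / (\<gamma> - 1))"
    using nz by simp
  have "starts_with (e_star_R \<gamma> \<Delta>x \<Delta>y a q i j)
      (\<rho>0 (i + 1) j * (p0 / (\<gamma> - 1) / \<rho>0 (i + 1) j
        + 0 * ((p0 * ?us - p0 * u0 (i + 1) j) / a0 i j)))"
    unfolding e_star_R_def
    by (intro starts_with_intros rho_star_starts_with ener_starts_with pres_starts_with
        p_star_starts_with u_star_starts_with dens velx relax assms nz)
  then show "starts_with (e_star_R \<gamma> \<Delta>x \<Delta>y a q i j) (p0 / (\<gamma> - 1))"
    using nz by simp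
qed

lemma flux_x_cener:
  assumes "\<gamma> \<noteq> 1"
  shows "starts_with (cener (flux_x \<gamma> \<Delta>x \<Delta>y a q i j))
    (inJ csum (inI esum u0) i j / 8 * (p0 / (\<gamma> - 1) + p0))"
proof -
  let ?es = "if fls_pos (u_star a q i j) then e_star_L \<gamma> \<Delta>x \<Delta>y a q i j
    else e_star_R \<gamma> \<Delta>x \<Delta>y a q i j"
  \<comment> \<open>Both branches have the same leading coefficient, so the upwind direction drops
    out at this order.\<close>
  have "starts_with ?es (p0 / (\<gamma> - 1))"
    by (simp add: e_star_starts_with assms)
  then have "starts_with (u_star a q i j * ?es + u_star a q i j * p_star \<Delta>x \<Delta>y a q i j)
      (inJ csum (inI esum u0) i j / 8 * (p0 / (\<gamma> - 1))
        + inJ csum (inI esum u0) i j / 8 * p0)"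
    by (intro starts_with_intros p_star_starts_with u_star_starts_with)
  then show ?thesis
    by (simp add: flux_x_def Let_def distrib_left)
qed

text \<open>The upwind choice may vary from edge to edge, but it only enters terms without negative
  powers. Their constant coefficient does not matter, hence the existential.\<close>

lemma flux_x_momentum:
  shows "\<exists>c. starts_with (cmomx (flux_x \<gamma> \<Delta>x \<Delta>y a q i j)
           - (fls_const p0 + eps * fls_const p1) / eps\<^sup>2) c"
    and "\<exists>c. starts_with (cmomy (flux_x \<gamma> \<Delta>x \<Delta>y a q i j)) c"
proof -
  let ?left = "fls_pos (u_star a q i j)"
  let ?\<rho>s = "if ?left then rho_star_L \<Delta>x \<Delta>y a q i j else rho_star_R \<Delta>x \<Delta>y a q i j"
  let ?vs = "if ?left then vely q i j else vely q (i + 1) j"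
  have \<rho>s: "starts_with ?\<rho>s (if ?left then \<rho>0 i j else \<rho>0 (i + 1) j)"
    by (simp add: rho_star_starts_with)
  have vs: "starts_with ?vs (if ?left then v0 i j else v0 (i + 1) j)"
    by (simp add: vely)
  obtain r c where r: "p_star \<Delta>x \<Delta>y a q i j = fls_const p0 + eps * fls_const p1 + eps\<^sup>2 * r"
    "starts_with r c"
    by (rule p_star_expansion)
  have "(w + eps\<^sup>2 * r) / eps\<^sup>2 - w / eps\<^sup>2 = r" for w
    by (subst add_divide_distrib, subst nonzero_mult_div_cancel_left) simp_all
  moreover have "cmomx (flux_x \<gamma> \<Delta>x \<Delta>y a q i j)
      = (u_star a q i j)\<^sup>2 * ?\<rho>s
        + (fls_const p0 + eps * fls_const p1 + eps\<^sup>2 * r) / eps\<^sup>2"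
    unfolding flux_x_def Let_def r(1) by simp
  ultimately have "cmomx (flux_x \<gamma> \<Delta>x \<Delta>y a q i j)
        - (fls_const p0 + eps * fls_const p1) / eps\<^sup>2
      = (u_star a q i j)\<^sup>2 * ?\<rho>s + r"
    by (metis add_diff_eq)
  then show "\<exists>c. starts_with (cmomx (flux_x \<gamma> \<Delta>x \<Delta>y a q i j)
           - (fls_const p0 + eps * fls_const p1) / eps\<^sup>2) c"
    using starts_with_add[OF starts_with_mult[OF starts_with_power[OF u_star_starts_with] \<rho>s] r(2)]
    by metis
  have "cmomy (flux_x \<gamma> \<Delta>x \<Delta>y a q i j) = u_star a q i j * ?vs * ?\<rho>s"
    by (simp add: flux_x_def Let_def)
  then show "\<exists>c. starts_with (cmomy (flux_x \<gamma> \<Delta>x \<Delta>y a q i j)) c"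
    using starts_with_mult[OF starts_with_mult[OF u_star_starts_with vs] \<rho>s] by metis
qed

lemma flux_x_momentum_nth:
  assumes "k < 0"
  shows "fls_nth (cmomx (flux_x \<gamma> \<Delta>x \<Delta>y a q i j)) k
      = fls_nth ((fls_const p0 + eps * fls_const p1) / eps\<^sup>2) k"
    and "fls_nth (cmomy (flux_x \<gamma> \<Delta>x \<Delta>y a q i j)) k = 0"
  using flux_x_momentum[of \<gamma> i j] starts_with_nth_neg[OF _ assms] by fastforce+

end

section \<open>Exchange of coordinates, cell balance, and passage from the data to the
  locale\<close>

lemma discrete_div_transp:
  "discrete_div \<Delta>y \<Delta>x (transp v) (transp u) i j = discrete_div \<Delta>x \<Delta>y u v j i"
  by (simp add: discrete_div_def transp_def inI_def inJ_def esum_def ejump_def algebra_simps)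

text \<open>The difference of \<open>esum\<close> at i and i-1 is the sum of \<open>ejump\<close> at
  i and i-1, while \<open>csum\<close> is the sum of \<open>esum\<close> at j and j-1; likewise with
  the indices exchanged for v. The factor 2 offsets the denominators in
  \<open>discrete_div\<close>.\<close>

lemma corner_divergences:
  fixes u v :: "real grid"
  assumes "\<And>i j. discrete_div \<Delta>x \<Delta>y u v i j = 0"
  shows "(inJ csum (inI esum u) i j - inJ csum (inI esum u) (i - 1) j) / \<Delta>x
    + (inJ csum (inI esum (transp v)) j i - inJ csum (inI esum (transp v)) (j - 1) i) / \<Delta>y = 0"
proof -
  have "(inJ csum (inI esum u) i j - inJ csum (inI esum u) (i - 1) j) / \<Delta>x
      + (inJ csum (inI esum (transp v)) j i - inJ csum (inI esum (transp v)) (j - 1) i) / \<Delta>y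
    = 2 * (discrete_div \<Delta>x \<Delta>y u v i j + discrete_div \<Delta>x \<Delta>y u v i (j - 1)
      + discrete_div \<Delta>x \<Delta>y u v (i - 1) j + discrete_div \<Delta>x \<Delta>y u v (i - 1) (j - 1))"
    by (simp add: discrete_div_def transp_def inI_def inJ_def csum_def esum_def ejump_def
        diff_divide_distrib add_divide_distrib)
  then show ?thesis
    by (simp add: assms)
qed

lemma low_mach_stateI:
  fixes \<rho> u v p a :: data
  assumes "\<Delta>x > 0" "\<Delta>y > 0"
    and "\<And>i j. fps_nth (\<rho> n i j) 0 > 0" "\<And>i j. fps_nth (a n i j) 0 > 0"
    and p: "\<And>i j. fps_nth (p n i j) 0 = p0" "\<And>i j. fps_nth (p n i j) 1 = p1"
    and "\<And>i j. discrete_div \<Delta>x \<Delta>y (\<lambda>i j. fps_nth (u n i j) 0) (\<lambda>i j. fps_nth (v n i j) 0) i j = 0"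
  shows "low_mach_state (state_of \<rho> u v p n) (series_grid a n) \<Delta>x \<Delta>y p0 p1
    (\<lambda>i j. fps_nth (\<rho> n i j) 0) (\<lambda>i j. fps_nth (u n i j) 0) (\<lambda>i j. fps_nth (v n i j) 0)
    (\<lambda>i j. fps_nth (a n i j) 0) (\<lambda>i j. fps_nth (p n i j) 2)
    (\<lambda>i j. fps_to_fls (fps_shift 2 (p n i j)))"
proof
  show "pres (state_of \<rho> u v p n) i j
      = fls_const p0 + eps * fls_const p1 + eps\<^sup>2 * fps_to_fls (fps_shift 2 (p n i j))" for i j
  proof -
    have "p n i j = fps_const p0 + fps_X * fps_const p1 + fps_X\<^sup>2 * fps_shift 2 (p n i j)"
    proof (rule fps_ext)
      fix k
      show "fps_nth (p n i j) k
        = fps_nth (fps_const p0 + fps_X * fps_const p1 + fps_X\<^sup>2 * fps_shift 2 (p n i j)) k"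
        \<comment> \<open>For k at least 2, writing k as 2 + (k - 2) matches the index in the
          shifted series.\<close>
        using p[of i j] le_add_diff_inverse[of 2 k]
        by (cases "k = 0"; cases "k = 1") (auto simp: fps_X_power_mult_nth)
    qed
    then have "fps_to_fls (p n i j)
        = fps_to_fls (fps_const p0 + fps_X * fps_const p1 + fps_X\<^sup>2 * fps_shift 2 (p n i j))"
      by (rule arg_cong)
    then show ?thesis
      by (simp add: state_of_def series_grid_def fls_times_fps_to_fls fps_to_fls_power)
  qed
  show "starts_with (fps_to_fls (fps_shift 2 (p n i j))) (fps_nth (p n i j) 2)" for i j
    using starts_with_fps_to_fls[of "fps_shift 2 (p n i j)"] by (simp add: numeral_2_eq_2)
qed (use assms in \<open>auto simp: state_of_def series_grid_def intro: starts_with_fps_to_fls\<close>)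

text \<open>Since \<open>flux_y\<close> is \<open>flux_x\<close> of transposed data, this makes
  every estimate of the locale available in the second direction.\<close>

lemma low_mach_state_transp:
  assumes "low_mach_state q a \<Delta>x \<Delta>y p0 p1 \<rho>0 u0 v0 a0 \<pi>0 \<pi>"
  shows "low_mach_state (transp_state q) (transp a) \<Delta>y \<Delta>x p0 p1
    (transp \<rho>0) (transp v0) (transp u0) (transp a0) (transp \<pi>0) (transp \<pi>)"
proof -
  interpret low_mach_state q a \<Delta>x \<Delta>y p0 p1 \<rho>0 u0 v0 a0 \<pi>0 \<pi> by fact
  show ?thesis
    by unfold_locales
      (simp_all only: discrete_div_transp, simp_all add: transp_state_def transp_def spacing dens
        dens_pos velx vely relax relax_pos pres pert div_free)
qed

section \<open>The discrete limit equations\<close>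

theorem theorem4p1:
  fixes \<gamma> \<Delta>t \<Delta>x \<Delta>y :: real
    and \<rho> u v p :: "nat \<Rightarrow> int \<Rightarrow> int \<Rightarrow> real fps"
    and a b :: "nat \<Rightarrow> int \<Rightarrow> int \<Rightarrow> real fps"
  assumes "\<gamma> > 1" and "\<Delta>t > 0" and "\<Delta>x > 0" and "\<Delta>y > 0"
    and "\<forall>n i j. fps_nth (\<rho> n i j) 0 > 0"
    and "\<forall>n i j. fps_nth (a n i j) 0 > 0"
    and "\<forall>n i j. fps_nth (b n i j) 0 > 0"
    and "\<exists>p0. \<forall>n i j. fps_nth (p n i j) 0 = p0"
    and "\<exists>p1. \<forall>n i j. fps_nth (p n i j) 1 = p1"
    and "\<forall>n i j. discrete_div \<Delta>x \<Delta>y (\<lambda>i j. fps_nth (u n i j) 0) (\<lambda>i j. fps_nth (v n i j) 0) i j = 0"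
  shows "discrete_limit_equations \<gamma> \<Delta>t \<Delta>x \<Delta>y a b \<rho> u v p"
proof -
  obtain p0 p1 where p: "\<And>n i j. fps_nth (p n i j) 0 = p0" "\<And>n i j. fps_nth (p n i j) 1 = p1"
    using assms(8,9) by blast
  have \<gamma>: "\<gamma> \<noteq> 1"
    using assms(1) by simp
  define U V where "U n i j = fps_nth (u n i j) 0" and "V n i j = fps_nth (v n i j) 0" for n i j
  \<comment> \<open>The time level stays schematic, and the premises on density, relaxation
    parameter and divergence stay open until each use.\<close>
  note X = low_mach_stateI[of \<Delta>x \<Delta>y \<rho> _ a p p0 p1 u v, OF assms(3,4) _ _ p]
  note Y = low_mach_stateI[of \<Delta>x \<Delta>y \<rho> _ b p p0 p1 u v, OF assms(3,4) _ _ p,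
      THEN low_mach_state_transp]
  let ?Q = "state_of \<rho> u v p"
  let ?P = "\<lambda>k. fls_nth ((fls_const p0 + eps * fls_const p1) / eps\<^sup>2) k"
  let ?fx = "\<lambda>n. flux_x \<gamma> \<Delta>x \<Delta>y (series_grid a n) (?Q n)"
  let ?fy = "\<lambda>n. flux_y \<gamma> \<Delta>x \<Delta>y (series_grid b n) (?Q n)"
  let ?C = "p0 / (\<gamma> - 1) + p0"
  \<comment> \<open>\<open>?P\<close> depends on neither the cell nor the time level, so it cancels
    in the flux differences. For \<open>?fy\<close> the momentum components and the cell indices are
    swapped.\<close>
  have mom: "fls_nth (cmomx (?fx n i j)) k = ?P k" "fls_nth (cmomy (?fx n i j)) k = 0"
    "fls_nth (cmomy (?fy n i j)) k = ?P k" "fls_nth (cmomx (?fy n i j)) k = 0"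
    if "k < 0" for n i j k
    using low_mach_state.flux_x_momentum_nth[OF X that, of n \<gamma> i j]
      low_mach_state.flux_x_momentum_nth[OF Y that, of n \<gamma> j i] assms(5-7,10)
    by (simp_all add: flux_y_def Let_def)
  have enx: "fls_nth (cener (?fx n i j)) 0 = inJ csum (inI esum (U n)) i j / 8 * ?C" for n i j
    using starts_with_nth_0[OF low_mach_state.flux_x_cener[OF X \<gamma>, of n i j]] assms(5-7,10)
    by (simp add: U_def[abs_def])
  have eny: "fls_nth (cener (?fy n i j)) 0 = inJ csum (inI esum (transp (V n))) j i / 8 * ?C"
    for n i j
    using starts_with_nth_0[OF low_mach_state.flux_x_cener[OF Y \<gamma>, of n j i]] assms(5-7,10)
    by (simp add: V_def[abs_def] flux_y_def Let_def)
  \<comment> \<open>The value is the same at all time levels, which gives the constancy of the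
    leading energy in time.\<close>
  have en: "fls_nth (ener \<gamma> (?Q n) i j) 0 = p0 / (\<gamma> - 1)" for n i j
    using starts_with_nth_0[OF low_mach_state.ener_starts_with[OF X \<gamma>, of n i j]] assms(5-7,10)
    by simp
  have "\<Delta>t / \<Delta>x * (fls_nth (cener (?fx n i j)) 0 - fls_nth (cener (?fx n (i - 1) j)) 0)
      + \<Delta>t / \<Delta>y * (fls_nth (cener (?fy n i j)) 0 - fls_nth (cener (?fy n i (j - 1))) 0) = 0"
    for n i j
  proof -
    \<comment> \<open>The common enthalpy factor \<open>?C\<close> and the 1/8 of the velocity
      averages are pulled out, leaving the sum over the four corners.\<close>
    have "\<Delta>t / \<Delta>x * (fls_nth (cener (?fx n i j)) 0 - fls_nth (cener (?fx n (i - 1) j)) 0)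
      + \<Delta>t / \<Delta>y * (fls_nth (cener (?fy n i j)) 0 - fls_nth (cener (?fy n i (j - 1))) 0)
      = \<Delta>t * ?C / 8 *
        ((inJ csum (inI esum (U n)) i j - inJ csum (inI esum (U n)) (i - 1) j) / \<Delta>x
         + (inJ csum (inI esum (transp (V n))) j i
            - inJ csum (inI esum (transp (V n))) (j - 1) i) / \<Delta>y)"
      unfolding enx eny
      by (simp add: algebra_simps diff_divide_distrib add_divide_distrib)
    also have "\<dots> = 0"
      using corner_divergences[of \<Delta>x \<Delta>y "U n" "V n" i j] assms(10)
      by (simp add: U_def[abs_def] V_def[abs_def])
    finally show ?thesis .
  qed
  then show ?thesis
    unfolding discrete_limit_equations_iff Let_def
    by (simp add: flux_difference_def mom en)
qed

end
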